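(* Let $k\ge1$, $m\ge0$, let $n_1,\dots,n_k$ be pairwise relatively prime positive integers, put $s=n_1+\cdots+n_k$, and let $p(x)\in\mathbb{Q}[x]$ with $\deg p(x)<s+m$. Then $$\sum_{j=1}^{k}S_0(n_1,\dots,\widehat{n_j},\dots,n_k;\,n_j)=p(0)-\mathrm{poly}(0).$$
   Context: The hat means that the corresponding entry is omitted. For a positive integer $b$ coprime to integers $m_1,\dots,m_r$ ($r\ge0$) and $t\in\mathbb{Z}$, the generalized Fourier–Dedekind sum (attached to $p$ and $m$) is $$S_t(m_1,\dots,m_r;b)=\frac1b\sum_{i=1}^{b-1}\frac{p(\xi^i)\,\xi^{it}}{(1-\xi^i)^m(1-\xi^{im_1})\cdots(1-\xi^{im_r})},\qquad \xi=e^{2\pi i/b}$$ (in the exponent of $e$, $i=\sqrt{-1}$); for $r=0$ the product over the $m_l$ is empty. For $n\ge1$, $\Psi_n(x)=1+x+\cdots+x^{n-1}$, and $f^{(n)}_j(x)=\big(-\tfrac1n x\Psi_n'(x)\big)^j\ \mathrm{rem}\ \Psi_n(x)$ for $j\ge1$, $f^{(n)}_0(x)=1$, where $f\ \mathrm{rem}\ q$ is the remainder of $f$ on Euclidean division by $q$. Write $p(x)=\sum_{i\ge0}a_i(1-x)^i$. For $0\le j\le m+k-1$ put $$c_j=\frac{1}{n_1\cdots n_k}\sum_{i+i_1+\cdots+i_k=j}a_i f^{(n_1)}_{i_1}(1)\cdots f^{(n_k)}_{i_k}(1)$$ (sum over non-negative integers), and let $\mathrm{poly}$ be the polynomial $$\mathrm{poly}(n)=\sum_{j=0}^{m+k-1}c_j\binom{n+m+k-j-1}{m+k-j-1},$$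 where $\binom{n+l-1}{l-1}=\frac{(n+1)(n+2)\cdots(n+l-1)}{(l-1)!}$ is regarded as a polynomial in $n$. *)

theory Defs
  imports Complex_Main "HOL-Library.FuncSet" "HOL-Computational_Algebra.Computational_Algebra"
begin

text \<open>
  The generalized Fourier--Dedekind sum attached to \<open>p\<close> and \<open>m\<close>. The entries
  \<open>m\<^sub>1, \<dots>, m\<^sub>r\<close> form a finite family \<open>M\<close> indexed by \<open>L\<close>, so that omitting an entry is
  deleting its index; \<open>L = {}\<close> is the case \<open>r = 0\<close>. The sum is meant for \<open>b > 0\<close> coprime
  to every \<open>M l\<close> with \<open>l \<in> L\<close>, in which case no denominator vanishes.
\<close>

definition fourier_dedekind ::
    "rat poly \<Rightarrow> nat \<Rightarrow> int \<Rightarrow> 'i set \<Rightarrow> ('i \<Rightarrow> int) \<Rightarrow> nat \<Rightarrow> complex" where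
  "fourier_dedekind p m t L M b =
     (let \<xi> = exp (2 * of_real pi * \<i> / of_nat b) in
      1 / of_nat b *
      (\<Sum>i = 1..b - 1.
         poly (map_poly of_rat p) (\<xi> ^ i) * \<xi> powi (int i * t) /
         ((1 - \<xi> ^ i) ^ m * (\<Prod>l\<in>L. 1 - \<xi> powi (int i * M l)))))"

definition Psi :: "nat \<Rightarrow> rat poly" where
  "Psi n = (\<Sum>i<n. monom 1 i)"

definition f_rem :: "nat \<Rightarrow> nat \<Rightarrow> rat poly" where
  "f_rem n j = (if j = 0 then 1
     else (smult (- 1 / of_nat n) (monom 1 1 * pderiv (Psi n))) ^ j mod Psi n)"

text \<open>
  The coefficients \<open>a\<^sub>i\<close> of the expansion of \<open>p\<close> in powers of \<open>1 - x\<close> are the ordinary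
  coefficients of \<open>p (1 - x)\<close>; see \<open>expansion_at_one\<close> below.
\<close>

definition a_coeff :: "rat poly \<Rightarrow> nat \<Rightarrow> rat" where
  "a_coeff p i = coeff (pcompose p [:1, - 1:]) i"

lemma expansion_at_one:
  "p = (\<Sum>i\<le>degree p. smult (a_coeff p i) ([:1, - 1:] ^ i))"
proof -
  let ?q = "pcompose p [:1, - 1:]"
  have deg: "degree ?q = degree p"
    by (simp add: degree_pcompose)
  have "p = pcompose ?q [:1, - 1:]"
    by (simp add: pcompose_assoc[symmetric] pcompose_pCons pcompose_idR)
  also have "\<dots> = (\<Sum>i\<le>degree ?q. smult (coeff ?q i) ([:1, - 1:] ^ i))"
    by (simp only: pcompose_altdef poly_altdef)
      (simp add: degree_map_poly coeff_map_poly)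
  finally show ?thesis
    by (simp add: deg a_coeff_def)
qed

text \<open>
  The tuples \<open>(i, i\<^sub>1, \<dots>, i\<^sub>k)\<close> of non-negative integers with sum \<open>j\<close>, the last \<open>k\<close>
  entries as a function on \<open>{1..k}\<close> (extensional, so that tuples are counted once).
\<close>

definition index_tuples :: "nat \<Rightarrow> nat \<Rightarrow> (nat \<times> (nat \<Rightarrow> nat)) set" where
  "index_tuples k j = {(i, u). u \<in> {1..k} \<rightarrow>\<^sub>E UNIV \<and> i + (\<Sum>l = 1..k. u l) = j}"

lemma finite_index_tuples: "finite (index_tuples k j)"
proof (rule finite_subset)
  show "index_tuples k j \<subseteq> {..j} \<times> ({1..k} \<rightarrow>\<^sub>E {..j})"
  proof (clarsimp simp: index_tuples_def)
    fix i u assume u: "u \<in> {Suc 0..k} \<rightarrow>\<^sub>E (UNIV :: nat set)"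
    have "u l \<le> i + sum u {Suc 0..k}" if "l \<in> {Suc 0..k}" for l
      using member_le_sum[of l "{Suc 0..k}" u] that by simp
    then show "u \<in> {Suc 0..k} \<rightarrow>\<^sub>E {..i + sum u {Suc 0..k}}"
      using u by (auto simp: PiE_iff)
  qed
  show "finite ({..j} \<times> ({1..k} \<rightarrow>\<^sub>E {..j}))"
    by (intro finite_cartesian_product finite_PiE) auto
qed

definition c_coeff :: "rat poly \<Rightarrow> nat \<Rightarrow> (nat \<Rightarrow> nat) \<Rightarrow> nat \<Rightarrow> rat" where
  "c_coeff p k n j =
     1 / (\<Prod>l = 1..k. of_nat (n l)) *
     (\<Sum>(i, u)\<in>index_tuples k j. a_coeff p i * (\<Prod>l = 1..k. poly (f_rem (n l) (u l)) 1))"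

text \<open>
  For \<open>l \<ge> 1\<close>, the binomial coefficient \<open>(x + l - 1 choose l - 1)\<close> as a polynomial in \<open>x\<close>,
  that is, \<open>(x + 1) \<cdots> (x + l - 1) / (l - 1)!\<close>.
\<close>

definition binom_poly :: "nat \<Rightarrow> rat poly" where
  "binom_poly l = smult (1 / fact (l - 1)) (\<Prod>i = 1..l - 1. [:of_nat i, 1:])"

definition poly_part :: "rat poly \<Rightarrow> nat \<Rightarrow> nat \<Rightarrow> (nat \<Rightarrow> nat) \<Rightarrow> rat poly" where
  "poly_part p m k n = (\<Sum>j = 0..m + k - 1. smult (c_coeff p k n j) (binom_poly (m + k - j)))"

end

theory Submission imports Defs begin

text \<open>
  Put \<open>D = \<Psi>\<^bsub>n\<^sub>1\<^esub> \<cdots> \<Psi>\<^bsub>n\<^sub>k\<^esub>\<close>, whose roots are simple because the \<open>n\<^sub>j\<close> are pairwise coprime.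
  Differentiating \<open>(1 - x) \<Psi>\<^sub>n = 1 - x\<^sup>n\<close> shows that \<open>-x \<Psi>\<^sub>n' / n\<close> inverts \<open>1 - x\<close> modulo \<open>\<Psi>\<^sub>n\<close>,
  so \<open>1 / \<Psi>\<^sub>n\<close> has the expansion \<open>\<Sum> f\<^sub>j(1) (1 - x)\<^sup>j / n\<close> at \<open>1\<close> and the \<open>c\<^sub>j\<close> are the
  Taylor coefficients of \<open>p / D\<close> there. Hence \<open>p = D Q + (1 - x)\<^bsup>m+k\<^esup> R\<close> with
  \<open>Q = \<Sum> c\<^sub>j (1 - x)\<^sup>j\<close>, where \<open>Q(0) = poly(0)\<close> and \<open>deg R < deg D\<close>. Lagrange interpolation
  of \<open>R\<close> at the roots of \<open>D\<close>, evaluated at \<open>0\<close>, writes \<open>p(0) - poly(0) = R(0)\<close> as a sum over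
  nontrivial \<open>n\<^sub>j\<close>-th roots of unity, which is the sum of the Fourier--Dedekind sums.
\<close>

section \<open>Interpolation at simple roots\<close>

lemma lagrange_interpolation:
  fixes D R :: "'a::field poly"
  assumes "finite Z" and deg: "degree D = card Z" "R \<noteq> 0 \<Longrightarrow> degree R < card Z"
    and D0: "\<And>z. z \<in> Z \<Longrightarrow> poly D z = 0"
    and D1: "\<And>z. z \<in> Z \<Longrightarrow> poly (pderiv D) z \<noteq> 0"
    and x: "x \<notin> Z"
  shows "poly R x = (\<Sum>z\<in>Z. poly R z / poly (pderiv D) z * (poly D x / (x - z)))"
\<comment> \<open>If \<open>Z\<close> is empty, the degree hypothesis forces \<open>R = 0\<close>,
  whose conventional degree 0 is not below \<open>card Z\<close>; hence the separate case.\<close>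
proof (cases "R = 0")
  case False
  with deg have deg: "degree D = card Z" "degree R < card Z" by auto
  \<comment> \<open>The cofactor of \<open>x - z\<close> in \<open>D\<close> takes the value D'(z)
    at \<open>z\<close> and vanishes at the other nodes, so dividing it by D'(z) gives the Lagrange
    basis.\<close>
  define E where "E z = synthetic_div D z" for z
  have D: "D = [:-z, 1:] * E z" if "z \<in> Z" for z
    using synthetic_div_correct'[of z D] D0[OF that] by (simp add: E_def)
  have E_same: "poly (E z) z = poly (pderiv D) z" if "z \<in> Z" for z
    by (subst D[OF that], subst pderiv_mult) (simp add: pderiv_pCons)
  have E_other: "poly (E z) w = 0" if "z \<in> Z" "w \<in> Z" "w \<noteq> z" for z w
  proof -
    have "(w - z) * poly (E z) w = poly D w"
      by (subst D[OF that(1)]) (simp add: algebra_simps)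
    then show ?thesis using D0[OF that(2)] that(3) by simp
  qed
  let ?L = "\<Sum>z\<in>Z. smult (poly R z / poly (pderiv D) z) (E z)"
  have "R = ?L"
  proof (rule poly_eqI_degree)
    fix w assume w: "w \<in> Z"
    have "poly ?L w = (\<Sum>z\<in>Z. if z = w then poly R w else 0)"
      unfolding poly_sum
      by (rule sum.cong) (auto simp: E_same E_other D1 w)
    then show "poly R w = poly ?L w"
      using w \<open>finite Z\<close> by simp
  next
    show "degree ?L < card Z"
      using deg by (intro degree_sum_less order.strict_trans1[OF degree_smult_le])
        (auto simp: E_def degree_synthetic_div)
  qed (use deg in auto)
  also have "poly \<dots> x = (\<Sum>z\<in>Z. poly R z / poly (pderiv D) z * (poly D x / (x - z)))"
    unfolding poly_sum
  proof (rule sum.cong)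
    fix z assume z: "z \<in> Z"
    have "poly D x = (x - z) * poly (E z) x"
      by (subst D[OF z]) (simp add: algebra_simps)
    then show "poly (smult (poly R z / poly (pderiv D) z) (E z)) x =
        poly R z / poly (pderiv D) z * (poly D x / (x - z))"
      using x z by auto
  qed simp
  finally show ?thesis .
qed simp

text \<open>In the product rule, every summand that does not differentiate \<open>f a\<close> keeps
  it as a factor and so vanishes at \<open>z\<close>.\<close>

lemma poly_pderiv_prod_simple:
  fixes f :: "'i \<Rightarrow> 'a::idom poly"
  assumes "finite A" "a \<in> A" "poly (f a) z = 0"
  shows "poly (pderiv (prod f A)) z = poly (pderiv (f a)) z * (\<Prod>b\<in>A - {a}. poly (f b) z)"
proof -
  have "poly (pderiv (prod f A)) z =
      (\<Sum>b\<in>A. if b = a then poly (pderiv (f a)) z * (\<Prod>b\<in>A - {a}. poly (f b) z) else 0)"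
    unfolding pderiv_prod poly_sum
  proof (rule sum.cong)
    fix b assume "b \<in> A"
    show "poly (prod f (A - {b}) * pderiv (f b)) z =
      (if b = a then poly (pderiv (f a)) z * (\<Prod>b\<in>A - {a}. poly (f b) z) else 0)"
    proof (cases "b = a")
      case False
      have "(\<Prod>c\<in>A - {b}. poly (f c) z) = 0"
        using assms False by (intro prod_zero bexI[of _ a]) auto
      then show ?thesis using False by (simp add: poly_prod)
    qed (simp add: poly_prod)
  qed simp
  then show ?thesis using assms by simp
qed

section \<open>Passage from rational coefficients to a field of characteristic zero\<close>

lemma map_poly_of_rat_add:
  "map_poly of_rat (p + q) = map_poly of_rat p + (map_poly of_rat q :: 'a::field_char_0 poly)"
  by (intro poly_eqI) (simp add: coeff_map_poly of_rat_add)

lemma map_poly_of_rat_diff: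
  "map_poly of_rat (p - q) = map_poly of_rat p - (map_poly of_rat q :: 'a::field_char_0 poly)"
  by (intro poly_eqI) (simp add: coeff_map_poly of_rat_diff)

lemma map_poly_of_rat_smult:
  "map_poly of_rat (smult c p) = smult (of_rat c) (map_poly of_rat p :: 'a::field_char_0 poly)"
  by (intro poly_eqI) (simp add: coeff_map_poly of_rat_mult)

lemma map_poly_of_rat_pderiv:
  "map_poly of_rat (pderiv p) = pderiv (map_poly of_rat p :: 'a::field_char_0 poly)"
  by (intro poly_eqI) (simp add: coeff_map_poly coeff_pderiv of_rat_mult of_rat_add)

lemma map_poly_of_rat_mult:
  "map_poly of_rat (p * q) = map_poly of_rat p * (map_poly of_rat q :: 'a::field_char_0 poly)"
  by (intro poly_eqI) (simp add: coeff_map_poly coeff_mult of_rat_sum of_rat_mult)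

lemma map_poly_of_rat_prod:
  "map_poly of_rat (prod f A) = (\<Prod>a\<in>A. map_poly of_rat (f a) :: 'a::field_char_0 poly)"
  by (induction A rule: infinite_finite_induct) (simp_all add: map_poly_of_rat_mult)

lemma map_poly_of_rat_power:
  "map_poly of_rat (p ^ j) = (map_poly of_rat p ^ j :: 'a::field_char_0 poly)"
  by (induction j) (simp_all add: map_poly_of_rat_mult)

lemma poly_map_poly_of_rat:
  "poly (map_poly of_rat p) (of_rat x) = (of_rat (poly p x) :: 'a::field_char_0)"
  by (induction p) (simp_all add: map_poly_pCons of_rat_add of_rat_mult)

section \<open>The polynomials Psi_n and the inverse of 1 - x modulo Psi_n\<close>

lemma poly_map_Psi:
  "poly (map_poly of_rat (Psi n)) (z::'a::field_char_0) = (\<Sum>i<n. z ^ i)"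
proof -
  have "map_poly of_rat (Psi n) = (\<Sum>i<n. monom (1::'a) i)"
    unfolding Psi_def by (intro poly_eqI) (simp add: coeff_map_poly coeff_sum of_rat_sum if_distrib cong: if_cong)
  then show ?thesis by (simp add: poly_sum poly_monom)
qed

lemma coeff_Psi: "coeff (Psi n) i = (if i < n then 1 else 0)"
  by (simp add: Psi_def coeff_sum)

lemma degree_Psi: "degree (Psi n) = n - 1"
  by (cases "n = 0") (simp add: Psi_def, auto intro!: antisym[OF degree_le le_degree] simp: coeff_Psi)

lemma Psi_nonzero: "n > 0 \<Longrightarrow> Psi n \<noteq> 0"
  using coeff_Psi[of n 0] by auto

lemma degree_prod_Psi:
  assumes "\<And>l. l \<in> A \<Longrightarrow> n l > 0"
  shows "degree (\<Prod>l\<in>A. Psi (n l)) = (\<Sum>l\<in>A. n l - 1)"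
  using assms by (subst degree_prod_sum_eq) (auto simp: Psi_nonzero degree_Psi)

lemma poly_Psi_1: "poly (Psi n) 1 = of_nat n"
  by (simp add: Psi_def poly_sum poly_monom)

lemma Psi_telescope: "[:1, - 1:] * Psi n = 1 - monom 1 n"
proof -
  have "1 - [:0, 1:] = ([:1, - 1:] :: rat poly)" by (simp add: one_pCons)
  then show ?thesis
    using one_diff_power_eq[of "[:0, 1:] :: rat poly" n] by (simp add: Psi_def monom_altdef)
qed

text \<open>Differentiate \<open>Psi_telescope\<close> and multiply by x: the last term becomes n
  x^n, which is n modulo Psi_n.\<close>

lemma Psi_deriv:
  assumes "n > 0"
  shows "[:1, - 1:] * (monom 1 1 * pderiv (Psi n)) =
    monom 1 1 * Psi n - smult (of_nat n) (monom 1 n)"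
proof -
  have "pderiv ([:1, - 1:] * Psi n) = pderiv (1 - monom 1 n)"
    by (simp only: Psi_telescope)
  then have *: "[:1, - 1:] * pderiv (Psi n) = Psi n - monom (of_nat n) (n - 1)"
    unfolding pderiv_mult by (simp add: pderiv_diff pderiv_monom pderiv_pCons del: mult_pCons_left)
  have "[:1, - 1:] * (monom 1 1 * pderiv (Psi n)) =
      monom 1 1 * (Psi n - monom (of_nat n) (n - 1))"
    unfolding *[symmetric] by (simp only: mult_ac)
  also have "\<dots> = monom 1 1 * Psi n - smult (of_nat n) (monom 1 n)"
    using assms by (simp add: right_diff_distrib mult_monom smult_monom)
  finally show ?thesis .
qed

text \<open>By \<open>Psi_deriv\<close> and x^n = 1 - (1 - x) Psi_n, the product of 1 - x and -x
  Psi_n'/n is 1 plus a multiple of Psi_n; then take \<open>j\<close>-th powers.\<close>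

lemma f_rem_inverse:
  assumes "n > 0" "j > 0"
  shows "(f_rem n j * [:1, - 1:] ^ j) mod Psi n = 1 mod Psi n"
proof -
  define g where "g = smult (- 1 / of_nat n) (monom 1 1 * pderiv (Psi n))"
  have "[:1, - 1:] * g = smult (- 1 / of_nat n) (monom 1 1 * Psi n) + monom 1 n"
    unfolding g_def mult_smult_right Psi_deriv[OF assms(1)]
    using assms by (simp add: smult_diff_right)
  also have "monom 1 n = 1 - [:1, - 1:] * Psi n" by (simp only: Psi_telescope)
  also have "smult (- 1 / of_nat n) (monom 1 1 * Psi n) + (1 - [:1, - 1:] * Psi n) =
      1 + (smult (- 1 / of_nat n) (monom 1 1) - [:1, - 1:]) * Psi n"
    by (simp add: left_diff_distrib)
  finally have "([:1, - 1:] * g) mod Psi n = 1 mod Psi n"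
    by (simp only: mod_mult_self1)
  then have "(([:1, - 1:] * g) ^ j) mod Psi n = 1 mod Psi n"
    by (metis power_mod power_one)
  moreover have "f_rem n j = g ^ j mod Psi n"
    using assms by (simp add: f_rem_def g_def)
  ultimately show ?thesis
    by (simp add: mod_mult_left_eq power_mult_distrib mult.commute del: mult_pCons_left mult_pCons_right)
qed

text \<open>The bound on \<open>h\<close> keeps it from contributing to the coefficient of (1 - x)^j
  at 1. It follows by comparing degrees in Psi_n h = 1 - (1 - x)^j f_j, where f_j has degree below n
  - 1 if j > 0 and n > 1.\<close>

lemma f_rem_identity:
  assumes "n > 0"
  obtains h where "1 = Psi n * h + [:1, - 1:] ^ j * f_rem n j"
    "h \<noteq> 0 \<Longrightarrow> degree h < j"
proof (cases "j = 0")
  case True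
  then show ?thesis by (intro that[of 0]) (auto simp: f_rem_def)
next
  case False
  then have "Psi n dvd 1 - f_rem n j * [:1, - 1:] ^ j"
    using f_rem_inverse[OF assms, of j] by (metis mod_eq_dvd_iff bot_nat_0.not_eq_extremum)
  then obtain h where h: "1 - f_rem n j * [:1, - 1:] ^ j = Psi n * h" by (elim dvdE)
  have "degree h < j" if "h \<noteq> 0"
  \<comment> \<open>For \<open>n = 1\<close> the modulus is 1 and the remainder 0, so the strict
    inequality between their degrees fails; instead \<open>h = 1\<close>.\<close>
  proof (cases "n = 1")
    case True
    then have "Psi n = 1" by (simp add: Psi_def)
    then have "f_rem n j = 0" using False by (simp add: f_rem_def)
    with h \<open>Psi n = 1\<close> have "h = 1" by simp
    then show ?thesis using False by simp
  next
    case n: False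
    have "degree (f_rem n j) < n - 1"
      using degree_mod_less'[of "Psi n" "smult (- 1 / of_nat n) (monom 1 1 * pderiv (Psi n)) ^ j"]
        n assms False Psi_nonzero[of n]
      by (cases "f_rem n j = 0") (auto simp: f_rem_def degree_Psi)
    then have "degree (f_rem n j * [:1, - 1:] ^ j) < n - 1 + j"
      using degree_mult_le[of "f_rem n j" "[:1, - 1:] ^ j"] degree_power_le[of "[:1, - 1:] :: rat poly" j]
      by (simp add: degree_power_eq)
    then have "degree (1 - f_rem n j * [:1, - 1:] ^ j) < n - 1 + j"
      by (intro degree_diff_less) auto
    then show ?thesis
      using that Psi_nonzero[OF assms] unfolding h by (simp add: degree_mult_eq degree_Psi)
  qed
  moreover have "1 = Psi n * h + [:1, - 1:] ^ j * f_rem n j"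
    using h by (simp add: algebra_simps)
  ultimately show ?thesis using that False by blast
qed

section \<open>Taylor expansions at 1 as formal power series, and the splitting of p\<close>

lemma pcompose_power: "pcompose (p ^ j) q = pcompose p q ^ j"
  for p q :: "'a::comm_semiring_1 poly"
  by (induction j) (simp_all add: pcompose_1 pcompose_mult)

text \<open>Substituting 1 - x for x moves the expansion point from 1 to 0: coefficient i is that of
  (1 - x)^i.\<close>

abbreviation reflect_fps :: "rat poly \<Rightarrow> rat fps" where
  "reflect_fps p \<equiv> fps_of_poly (pcompose p [:1, - 1:])"

text \<open>Dividing \<open>f_rem_identity\<close> by Psi_n gives 1/Psi_n = h + (1 - x)^j f_j/Psi_n.
  As h has degree below j, coefficient j is the value of f_j/Psi_n at 1, and Psi_n(1) = n.\<close>

lemma inverse_Psi_expansion: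
  assumes "n > 0"
  shows "inverse (reflect_fps (Psi n)) $ j = poly (f_rem n j) 1 / of_nat n"
proof -
  let ?G = "reflect_fps (Psi n)"
  have G0: "?G $ 0 = of_nat n"
    by (simp add: pcompose_coeff_0 poly_Psi_1)
  obtain h where h: "1 = Psi n * h + [:1, - 1:] ^ j * f_rem n j"
    "h \<noteq> 0 \<Longrightarrow> degree h < j"
    using f_rem_identity[OF assms, of j] by blast
  have "pcompose [:1, - 1:] [:1, - 1:] = ([:0, 1:] :: rat poly)"
    by (simp add: pcompose_pCons)
  then have pow: "reflect_fps ([:1, - 1:] ^ j) = fps_X ^ j"
    by (simp add: pcompose_power fps_of_poly_power fps_of_poly_fps_X)
  have "inverse ?G = inverse ?G * reflect_fps (Psi n * h + [:1, - 1:] ^ j * f_rem n j)"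
    by (simp flip: h(1) add: pcompose_1)
  also have "\<dots> = (inverse ?G * ?G) * reflect_fps h + fps_X ^ j * (inverse ?G * reflect_fps (f_rem n j))"
    by (simp only: pcompose_add pcompose_mult fps_of_poly_add fps_of_poly_mult pow) (simp only: algebra_simps)
  also have "inverse ?G * ?G = 1"
    using G0 assms by (intro inverse_mult_eq_1) simp
  finally have "inverse ?G $ j = (reflect_fps h + fps_X ^ j * (inverse ?G * reflect_fps (f_rem n j))) $ j"
    by simp
  also have "\<dots> = coeff (pcompose h [:1, - 1:]) j + poly (f_rem n j) 1 / of_nat n"
    using G0 by (simp add: fps_X_power_mult_nth pcompose_coeff_0 divide_inverse)
  also have "coeff (pcompose h [:1, - 1:]) j = 0"
    using h by (cases "h = 0") (auto intro!: coeff_eq_0 simp: degree_pcompose)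
  finally show ?thesis by simp
qed

text \<open>Multisets of size \<open>j\<close> over \<open>A\<close> correspond to their
  multiplicity functions, made extensional to match \<open>index_tuples\<close>.\<close>

lemma fps_prod_nth_PiE:
  fixes F :: "'i \<Rightarrow> 'a::comm_ring_1 fps"
  assumes "finite A"
  shows "(\<Prod>a\<in>A. F a) $ j = (\<Sum>u | u \<in> A \<rightarrow>\<^sub>E UNIV \<and> sum u A = j. \<Prod>a\<in>A. F a $ u a)"
  unfolding fps_prod_nth'[OF assms]
proof (rule sum.reindex_bij_witness[where
      i = "\<lambda>u. \<Sum>a\<in>A. replicate_mset (u a) a" and j = "\<lambda>X. restrict (count X) A"])
  fix X assume "X \<in> multisets_of_size A j"
  then have X: "set_mset X \<subseteq> A" "size X = j" by (auto simp: multisets_of_size_def)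
  show "(\<Sum>a\<in>A. replicate_mset (restrict (count X) A a) a) = X"
    using X assms by (intro multiset_eqI) (auto simp: count_sum not_in_iff)
  have "sum (count X) A = sum (count X) (set_mset X)"
    using X assms by (intro sum.mono_neutral_right) (auto simp: not_in_iff)
  then show "restrict (count X) A \<in> {u \<in> A \<rightarrow>\<^sub>E UNIV. sum u A = j}"
    using X by (auto simp: size_multiset_overloaded_eq)
  show "(\<Prod>a\<in>A. F a $ restrict (count X) A a) = (\<Prod>a\<in>A. F a $ count X a)"
    by simp
next
  fix u assume "u \<in> {u \<in> A \<rightarrow>\<^sub>E UNIV. sum u A = j}"
  then have u: "u \<in> A \<rightarrow>\<^sub>E UNIV" "sum u A = j" by auto
  show "restrict (count (\<Sum>a\<in>A. replicate_mset (u a) a)) A = u"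
  proof
    fix a
    show "restrict (count (\<Sum>a\<in>A. replicate_mset (u a) a)) A a = u a"
    proof (cases "a \<in> A")
      case True
      then show ?thesis using assms by (simp add: count_sum)
    next
      case False
      then show ?thesis using PiE_arb[OF u(1)] by simp
    qed
  qed
  show "(\<Sum>a\<in>A. replicate_mset (u a) a) \<in> multisets_of_size A j"
    using u assms by (auto simp: multisets_of_size_def size_multiset_sum set_mset_sum split: if_splits)
qed

text \<open>This identifies the c_j as the Taylor coefficients at 1 of p divided by the product of
  the Psi_{n_l}.\<close>

lemma c_coeff_expansion:
  assumes "\<And>l. l \<in> {1..k} \<Longrightarrow> n l > 0"
  shows "c_coeff p k n j =
    (reflect_fps p * (\<Prod>l = 1..k. inverse (reflect_fps (Psi (n l))))) $ j"
proof -
  let ?S = "\<lambda>j. {u. u \<in> {1..k} \<rightarrow>\<^sub>E UNIV \<and> (\<Sum>l = 1..k. u l) = j}"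
  \<comment> \<open>Splitting off the first entry matches the tuples with the Cauchy product of p
    and the remaining series.\<close>
  have idx: "index_tuples k j = Sigma {0..j} (\<lambda>i. ?S (j - i))"
    by (auto simp: index_tuples_def)
  have fin: "finite (?S i)" for i :: nat
    by (rule finite_subset[OF _ finite_imageI[OF finite_index_tuples[of k i], of snd]])
      (force simp: index_tuples_def image_iff)
  have "(reflect_fps p * (\<Prod>l = 1..k. inverse (reflect_fps (Psi (n l))))) $ j =
      (\<Sum>i = 0..j. a_coeff p i * (\<Sum>u\<in>?S (j - i). \<Prod>l = 1..k. poly (f_rem (n l) (u l)) 1 / of_nat (n l)))"
    using assms
    by (simp add: fps_mult_nth fps_prod_nth_PiE inverse_Psi_expansion a_coeff_def)
  also have "\<dots> = (\<Sum>(i, u)\<in>index_tuples k j. a_coeff p i * (\<Prod>l = 1..k. poly (f_rem (n l) (u l)) 1 / of_nat (n l)))"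
    unfolding idx by (subst sum.Sigma[symmetric]) (use fin in \<open>auto simp: sum_distrib_left\<close>)
  also have "\<dots> = c_coeff p k n j"
    unfolding c_coeff_def sum_distrib_left prod_dividef
    by (intro sum.cong) auto
  finally show ?thesis ..
qed

text \<open>Truncating the expansion of p/D at order m + k leaves an error p - D Q that vanishes to
  that order at 1; its cofactor is R.\<close>

lemma expansion_decomposition:
  assumes "k \<ge> 1" "\<And>l. l \<in> {1..k} \<Longrightarrow> n l > 0" "degree p < (\<Sum>l = 1..k. n l) + m"
  obtains R where
    "p = (\<Prod>l = 1..k. Psi (n l)) * (\<Sum>j<m + k. smult (c_coeff p k n j) ([:1, - 1:] ^ j)) +
      [:1, - 1:] ^ (m + k) * R"
    "R \<noteq> 0 \<Longrightarrow> degree R < (\<Sum>l = 1..k. n l - 1)"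
proof -
  define N where "N = m + k"
  define D where "D = (\<Prod>l = 1..k. Psi (n l))"
  define G where "G = pcompose D [:1, - 1:]"
  define q where "q = (\<Sum>j<N. monom (c_coeff p k n j) j)"
  \<comment> \<open>The reflected error p - D Q: vanishing at 1 becomes divisibility by a power of
    x.\<close>
  define e where "e = pcompose p [:1, - 1:] - G * q"
  have refl: "pcompose [:1, - 1:] [:1, - 1:] = ([:0, 1:] :: rat poly)"
    by (simp add: pcompose_pCons)
  have refl2: "pcompose (pcompose f [:1, - 1:]) [:1, - 1:] = f" for f :: "rat poly"
    by (simp add: pcompose_assoc[symmetric] refl)
  define F where "F = reflect_fps p * (\<Prod>l = 1..k. inverse (reflect_fps (Psi (n l))))"
  have "fps_of_poly G * (\<Prod>l = 1..k. inverse (reflect_fps (Psi (n l)))) =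
      (\<Prod>l = 1..k. inverse (reflect_fps (Psi (n l))) * reflect_fps (Psi (n l)))"
    by (simp add: G_def D_def pcompose_prod fps_of_poly_prod prod.distrib mult.commute)
  also have "\<dots> = 1"
    using assms(2)
    by (intro prod.neutral ballI inverse_mult_eq_1) (auto simp: pcompose_coeff_0 poly_Psi_1)
  finally have "reflect_fps p = fps_of_poly G * F"
    by (simp add: F_def mult.left_commute)
  then have e: "fps_of_poly e = fps_of_poly G * (F - fps_of_poly q)"
    by (simp add: e_def fps_of_poly_diff fps_of_poly_mult right_diff_distrib)
  have F: "F $ i = coeff q i" if "i < N" for i
    using that c_coeff_expansion[where k = k and n = n and p = p and j = i] assms(2) by (simp add: F_def q_def coeff_sum)
  have "coeff e i = 0" if "i < N" for i
  proof -
    have "coeff e i = (fps_of_poly G * (F - fps_of_poly q)) $ i"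
      by (simp flip: e)
    also have "\<dots> = 0"
      using that by (auto simp: fps_mult_nth F intro!: sum.neutral)
    finally show ?thesis .
  qed
  then have "monom 1 N dvd e" by (simp add: monom_1_dvd_iff')
  then obtain r where r: "e = monom 1 N * r" by (elim dvdE)
  have "p = pcompose (G * q + monom 1 N * r) [:1, - 1:]"
    unfolding r[symmetric] by (simp add: e_def refl2)
  also have "\<dots> = D * pcompose q [:1, - 1:] + [:1, - 1:] ^ N * pcompose r [:1, - 1:]"
    by (simp add: pcompose_add pcompose_mult G_def refl2 monom_altdef pcompose_power pcompose_pCons)
  also have "pcompose q [:1, - 1:] = (\<Sum>j<N. smult (c_coeff p k n j) ([:1, - 1:] ^ j))"
    by (simp add: q_def pcompose_sum monom_altdef pcompose_smult pcompose_power pcompose_pCons)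
  finally have decomp: "p = D * (\<Sum>j<N. smult (c_coeff p k n j) ([:1, - 1:] ^ j)) +
      [:1, - 1:] ^ N * pcompose r [:1, - 1:]" .
  have degD: "degree D = (\<Sum>l = 1..k. n l - 1)"
    unfolding D_def using assms(2) by (rule degree_prod_Psi)
  have "(\<Sum>l = 1..k. n l) = (\<Sum>l = 1..k. (n l - 1) + 1)"
    using assms(2) by (intro sum.cong) auto
  \<comment> \<open>Each n_l exceeds the degree of its Psi by one, so s is deg D + k; this turns the
    bound on deg p into one on deg R.\<close>
  then have s: "(\<Sum>l = 1..k. n l) + m = degree D + N"
    unfolding degD sum.distrib by (simp add: N_def)
  have "degree (pcompose r [:1, - 1:]) < degree D" if "pcompose r [:1, - 1:] \<noteq> 0"
  proof -
    have "r \<noteq> 0" using that by auto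
    \<comment> \<open>Here \<open>k \<ge> 1\<close> gives \<open>N > 0\<close>, so the bound holds
      even if \<open>q\<close> is zero.\<close>
    have "degree q < N"
      unfolding q_def using assms(1)
      by (intro degree_sum_less) (auto simp: N_def intro: order.strict_trans1[OF degree_monom_le])
    then have "degree (G * q) < degree D + N"
      using degree_mult_le[of G q] by (simp add: G_def degree_pcompose)
    then have "degree e < degree D + N"
      unfolding e_def using assms(3) s by (intro degree_diff_less) (auto simp: degree_pcompose)
    also have "degree e = N + degree r"
      using \<open>r \<noteq> 0\<close> by (simp add: r degree_mult_eq degree_monom_eq)
    finally show ?thesis by (simp add: degree_pcompose)
  qed
  then show ?thesis
    using that decomp unfolding N_def D_def[symmetric] degD[symmetric] by blast
qed

section \<open>Fourier-Dedekind sums as sums over roots of unity\<close>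

lemma fourier_dedekind_roots_of_unity:
  assumes "b > 0"
  shows "fourier_dedekind p m 0 L (\<lambda>l. int (n l)) b =
    (\<Sum>z | z ^ b = 1 \<and> z \<noteq> 1. poly (map_poly of_rat p) z /
      (of_nat b * (1 - z) ^ m * (\<Prod>l\<in>L. 1 - z ^ n l)))"
proof -
  define \<xi> where "\<xi> = exp (2 * of_real pi * \<i> / of_nat b)"
  have "\<xi> = cis (2 * pi / real b)"
    by (simp add: \<xi>_def cis_conv_exp mult_ac)
  then have pow: "\<xi> ^ i = cis (2 * pi * real i / real b)" for i
    by (simp add: DeMoivre mult_ac)
  have "bij_betw (\<lambda>i. \<xi> ^ i) {..<b} {z. z ^ b = 1}"
    unfolding pow by (rule bij_betw_roots_unity[OF assms])
  \<comment> \<open>Removing exponent 0 on one side removes exactly the root 1 on the other.\<close>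
  then have "bij_betw (\<lambda>i. \<xi> ^ i) ({..<b} - {0}) ({z. z ^ b = 1} - {\<xi> ^ 0})"
    using assms by (intro bij_betw_DiffI) (auto simp: bij_betw_def)
  moreover have "{..<b} - {0} = {1..b - 1}" using assms by auto
  moreover have "{z. z ^ b = 1} - {\<xi> ^ 0} = {z. z ^ b = 1 \<and> z \<noteq> 1}" by auto
  ultimately have bij: "bij_betw (\<lambda>i. \<xi> ^ i) {1..b - 1} {z. z ^ b = 1 \<and> z \<noteq> 1}"
    by simp
  have powi: "\<xi> powi (int i * int j) = (\<xi> ^ i) ^ j" for i j
    by (simp flip: of_nat_mult power_mult add: power_int_of_nat)
  have "fourier_dedekind p m 0 L (\<lambda>l. int (n l)) b =
      (\<Sum>i = 1..b - 1. poly (map_poly of_rat p) (\<xi> ^ i) /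
        (of_nat b * (1 - \<xi> ^ i) ^ m * (\<Prod>l\<in>L. 1 - (\<xi> ^ i) ^ n l)))"
    unfolding fourier_dedekind_def Let_def \<xi>_def[symmetric] powi sum_distrib_left
    by (intro sum.cong) (simp_all add: mult_ac)
  also have "\<dots> = (\<Sum>z | z ^ b = 1 \<and> z \<noteq> 1. poly (map_poly of_rat p) z /
      (of_nat b * (1 - z) ^ m * (\<Prod>l\<in>L. 1 - z ^ n l)))"
    by (rule sum.reindex_bij_betw[OF bij])
  finally show ?thesis .
qed

text \<open>By Bezout, some power of \<open>z ^ a\<close> equals \<open>z\<close> times a power of
  \<open>z ^ b\<close>.\<close>

lemma power_eq_one_coprime:
  fixes z :: complex
  assumes "z ^ a = 1" "z ^ b = 1" "coprime a b" "a > 0"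
  shows "z = 1"
proof -
  obtain x y where "a * x = b * y + 1"
    using bezout_nat[of a b] assms by auto
  then have "z ^ (a * x) = z ^ (b * y) * z" by simp
  then show ?thesis using assms by (simp add: power_mult)
qed

section \<open>Interpolation of R at the roots of D and evaluation at 0\<close>

theorem theorem6p2:
  fixes k m :: nat and n :: "nat \<Rightarrow> nat" and s :: nat and p :: "rat poly"
  assumes "k \<ge> 1"
    and "\<And>j. j \<in> {1..k} \<Longrightarrow> n j > 0"
    and "\<And>i j. i \<in> {1..k} \<Longrightarrow> j \<in> {1..k} \<Longrightarrow> i \<noteq> j \<Longrightarrow> coprime (n i) (n j)"
    and "s = (\<Sum>j = 1..k. n j)"
    and "degree p < s + m"
  shows "(\<Sum>j = 1..k. fourier_dedekind p m 0 ({1..k} - {j}) (\<lambda>l. int (n l)) (n j)) =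
    of_rat (poly p 0 - poly (poly_part p m k n) 0)"
proof -
  let ?C = "map_poly of_rat :: rat poly \<Rightarrow> complex poly"
  define D where "D = (\<Prod>l = 1..k. Psi (n l))"
  define Q where "Q = (\<Sum>j<m + k. smult (c_coeff p k n j) ([:1, - 1:] ^ j))"
  obtain R where decomp: "p = D * Q + [:1, - 1:] ^ (m + k) * R"
    and degR: "R \<noteq> 0 \<Longrightarrow> degree R < (\<Sum>l = 1..k. n l - 1)"
    using expansion_decomposition[where k = k and n = n and p = p and m = m] assms unfolding D_def Q_def by blast
  define Z where "Z j = {z :: complex. z ^ n j = 1 \<and> z \<noteq> 1}" for j
  have Z_eq: "Z j = {z. z ^ n j = 1} - {1}" for j by (auto simp: Z_def)
  have finZ: "finite (Z j)" if "j \<in> {1..k}" for j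
    using finite_roots_unity[of "n j"] assms(2)[OF that] by (auto simp: Z_eq Suc_le_eq)
  have cardZ: "card (Z j) = n j - 1" if "j \<in> {1..k}" for j
    unfolding Z_eq using assms(2)[OF that] by (subst card_Diff_singleton) (auto simp: card_roots_unity_eq)
  have disjoint: "Z i \<inter> Z j = {}" if "i \<in> {1..k}" "j \<in> {1..k}" "i \<noteq> j" for i j
    using power_eq_one_coprime assms(2,3) that by (auto simp: Z_def)
  \<comment> \<open>By coprimality the root sets are disjoint, so D has as many distinct roots as
    its degree.\<close>
  have card_Un: "card (\<Union>j\<in>{1..k}. Z j) = (\<Sum>l = 1..k. n l - 1)"
    using finZ disjoint cardZ by (subst card_UN_disjoint) auto

  have D_factors: "?C D = (\<Prod>l = 1..k. ?C (Psi (n l)))"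
    by (simp add: D_def map_poly_of_rat_prod)
  have Psi_val: "poly (?C (Psi l)) z = (1 - z ^ l) / (1 - z)" if "z \<noteq> 1" for l z
    using that by (simp add: poly_map_Psi sum_gp_strict)
  have Psi_root: "poly (?C (Psi (n j))) z = 0" if "z \<in> Z j" for z j
    using that by (simp add: Psi_val Z_def)
  \<comment> \<open>Evaluate \<open>Psi_deriv\<close> at z, where Psi vanishes and z^(n_j) =
    1.\<close>
  have Psi_deriv_root: "- z * poly (pderiv (?C (Psi (n j)))) z = of_nat (n j) / (1 - z)"
    if "j \<in> {1..k}" "z \<in> Z j" for z j
  proof -
    have "poly (?C ([:1, - 1:] * (monom 1 1 * pderiv (Psi (n j))))) z =
        poly (?C (monom 1 1 * Psi (n j) - smult (of_nat (n j)) (monom 1 (n j)))) z"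
      using assms(2)[OF that(1)] by (simp only: Psi_deriv)
    then have "(1 - z) * (z * poly (pderiv (?C (Psi (n j)))) z) = - of_nat (n j)"
      using that Psi_root[OF that(2)]
      by (simp add: map_poly_of_rat_mult map_poly_of_rat_diff map_poly_of_rat_smult map_poly_of_rat_pderiv
          map_poly_monom map_poly_pCons poly_monom Z_def of_rat_minus del: mult_pCons_left)
    then show ?thesis using that by (auto simp: Z_def field_simps)
  qed
  \<comment> \<open>D'(z) is the derivative of the vanishing factor times the other factors; (1 -
    z)^k clears one denominator from each of the k terms.\<close>
  have D_deriv: "- z * poly (pderiv (?C D)) z * (1 - z) ^ k = of_nat (n j) * (\<Prod>l\<in>{1..k} - {j}. 1 - z ^ n l)"
    if "j \<in> {1..k}" "z \<in> Z j" for z j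
  proof -
    have z: "z \<noteq> 1" using that by (simp add: Z_def)
    have "- z * poly (pderiv (?C D)) z =
        (- z * poly (pderiv (?C (Psi (n j)))) z) * (\<Prod>l\<in>{1..k} - {j}. (1 - z ^ n l) / (1 - z))"
      unfolding D_factors using that(1) Psi_root[OF that(2)] z
      by (subst poly_pderiv_prod_simple[of _ j]) (simp_all add: Psi_val[OF z])
    also have "\<dots> = of_nat (n j) * (\<Prod>l\<in>{1..k} - {j}. 1 - z ^ n l) / ((1 - z) * (1 - z) ^ (k - 1))"
      unfolding Psi_deriv_root[OF that] prod_dividef using that by simp
    also have "(1 - z) * (1 - z) ^ (k - 1) = (1 - z) ^ k"
      using assms(1) by (cases k) auto
    finally show ?thesis using z by (simp add: field_simps)
  qed
  have others: "(\<Prod>l\<in>{1..k} - {j}. 1 - z ^ n l) \<noteq> 0" if "j \<in> {1..k}" "z \<in> Z j" for z j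
  proof -
    have "z ^ n l \<noteq> 1" if "l \<in> {1..k} - {j}" for l
      using disjoint[of j l] that \<open>j \<in> {1..k}\<close> \<open>z \<in> Z j\<close> unfolding Z_def by blast
    then show ?thesis by simp
  qed
  have D_deriv_nz: "poly (pderiv (?C D)) z \<noteq> 0" if "j \<in> {1..k}" "z \<in> Z j" for z j
    using D_deriv[OF that] others[OF that] assms(2)[OF that(1)] by auto
  have D_root: "poly (?C D) z = 0" if "j \<in> {1..k}" "z \<in> Z j" for z j
    unfolding D_factors poly_prod using that Psi_root[OF that(2)] by (intro prod_zero bexI[of _ j]) auto
  \<comment> \<open>The term D Q vanishes at a root of D.\<close>
  have R_val: "poly (?C R) z * (1 - z) ^ (m + k) = poly (?C p) z" if "j \<in> {1..k}" "z \<in> Z j" for z j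
    unfolding decomp map_poly_of_rat_add map_poly_of_rat_mult map_poly_of_rat_power
    using D_root[OF that] by (simp add: map_poly_pCons of_rat_minus)
  have degD: "degree (?C D) = (\<Sum>l = 1..k. n l - 1)"
    using degree_prod_Psi[of "{1..k}" n] assms(2) by (simp add: D_def degree_map_poly)
  have degCR: "degree (?C R) < (\<Sum>l = 1..k. n l - 1)" if "?C R \<noteq> 0"
    using degR that by (cases "R = 0") (simp_all add: degree_map_poly)
  have zero_notin: "0 \<notin> (\<Union>j\<in>{1..k}. Z j)"
    using assms(2) by (auto simp: Z_def zero_power)

  have D_at_0: "poly D 0 = 1"
    unfolding D_def poly_prod
    using assms(2) by (intro prod.neutral) (auto simp: poly_0_coeff_0 coeff_Psi)
  \<comment> \<open>At 0 each \<open>binom_poly\<close> is (l - 1)!/(l - 1)! = 1, as is each power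
    of 1 - x, so poly(0) and Q(0) are both the sum of the c_j.\<close>
  have "poly (poly_part p m k n) 0 = (\<Sum>j = 0..m + k - 1. c_coeff p k n j)"
    unfolding poly_part_def poly_sum
    by (intro sum.cong) (simp_all add: binom_poly_def poly_prod fact_prod)
  also have "{0..m + k - 1} = {..<m + k}" using assms(1) by auto
  finally have "poly (poly_part p m k n) 0 = poly Q 0" by (simp add: Q_def poly_sum)
  then have "of_rat (poly p 0 - poly (poly_part p m k n) 0) = (of_rat (poly R 0) :: complex)"
    by (subst (1) decomp) (simp add: D_at_0)
  also have "\<dots> = poly (?C R) 0"
    using poly_map_poly_of_rat[of R 0, where ?'a = complex] by simp
  also have "\<dots> = (\<Sum>z\<in>(\<Union>j\<in>{1..k}. Z j).
      poly (?C R) z / poly (pderiv (?C D)) z * (poly (?C D) 0 / (0 - z)))"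
    by (rule lagrange_interpolation)
      (use finZ card_Un degD D_root D_deriv_nz zero_notin degCR in auto)
  also have "\<dots> = (\<Sum>j = 1..k. \<Sum>z\<in>Z j.
      poly (?C R) z / poly (pderiv (?C D)) z * (poly (?C D) 0 / (0 - z)))"
    using finZ disjoint by (intro sum.UNION_disjoint) auto
  also have "\<dots> = (\<Sum>j = 1..k. \<Sum>z\<in>Z j. poly (?C p) z /
      (of_nat (n j) * (1 - z) ^ m * (\<Prod>l\<in>{1..k} - {j}. 1 - z ^ n l)))"
  proof (intro sum.cong refl)
    fix j z assume jz: "j \<in> {1..k}" "z \<in> Z j"
    then have z: "1 - z \<noteq> 0" by (simp add: Z_def)
    have D0: "poly (?C D) 0 = 1"
      using poly_map_poly_of_rat[of D 0, where ?'a = complex] D_at_0 by simp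
    have "poly (?C p) z / (of_nat (n j) * (1 - z) ^ m * (\<Prod>l\<in>{1..k} - {j}. 1 - z ^ n l)) =
        poly (?C p) z / ((1 - z) ^ m * (of_nat (n j) * (\<Prod>l\<in>{1..k} - {j}. 1 - z ^ n l)))"
      by (simp only: mult_ac)
    \<comment> \<open>Of the power m + k of 1 - z in \<open>R_val\<close>, the part m cancels the
      explicit denominator and the part k the one in \<open>D_deriv\<close>; the factor -z is the
      interpolation denominator 0 - z.\<close>
    also have "\<dots> = poly (?C R) z / (- z * poly (pderiv (?C D)) z)"
      unfolding D_deriv[OF jz, symmetric] R_val[OF jz, symmetric] power_add using z by simp
    finally show "poly (?C R) z / poly (pderiv (?C D)) z * (poly (?C D) 0 / (0 - z)) =
        poly (?C p) z / (of_nat (n j) * (1 - z) ^ m * (\<Prod>l\<in>{1..k} - {j}. 1 - z ^ n l))"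
      by (simp add: D0 mult_ac)
  qed
  also have "\<dots> = (\<Sum>j = 1..k. fourier_dedekind p m 0 ({1..k} - {j}) (\<lambda>l. int (n l)) (n j))"
    using assms(2) by (intro sum.cong) (simp_all add: fourier_dedekind_roots_of_unity Z_def)
  finally show ?thesis ..
qed

end
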